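(* Let $\Gamma$ be a finite simple graph on $v$ vertices, let $s$ be a positive integer with $s<v$, and let $k,\lambda$ be real numbers. Define $$T_1:=v-(3+2k)s+2s^2,\qquad T_2:=4(v-s)\big((3+\lambda)s^2-s^3-(2+\lambda)s\big),$$ $$T_3:=(v-s)\left(1-\left|2\left(\frac{-v+(3+2k)s-2s^2}{2(v-s)}-\left\lfloor\frac{-v+(3+2k)s-2s^2}{2(v-s)}\right\rfloor\right)-1\right|\right),$$ and $\mathrm{CE}_\Gamma(s,k,\lambda):=T_1^2-T_2-T_3^2$. If $\mathrm{CE}_\Gamma(s,k,\lambda)>0$, then no $s$-clique $S$ of $\Gamma$ satisfies $(\langle k\rangle_S,\langle\lambda\rangle_S)=(k,\lambda)$.
   Context: For a graph $\Gamma$ and a vertex $u$, $\Gamma(u)$ denotes the set of neighbours of $u$. An $s$-clique is a set $S$ of $s$ pairwise adjacent vertices. For a clique $S$, $$\langle k\rangle_S:=\frac{1}{|S|}\sum_{u\in S}\deg_\Gamma(u),\qquad \langle\lambda\rangle_S:=\binom{|S|}{2}^{-1}\sum_{\{u,w\}\in\binom{S}{2}}|\Gamma(u)\cap\Gamma(w)|.$$ For $|S|=1$ the second average is empty and is taken to be $0$. *)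

theory Defs
  imports Complex_Main "HOL-Library.Ramsey" "Graph_Theory.Pair_Digraph"
begin

text \<open>
  Finite simple graphs are the structures satisfying \<^locale>\<open>pair_graph\<close>: finite loop-free
  digraphs without parallel arcs whose arc relation is symmetric, so that each undirected edge
  is present as two opposite arcs. Degrees are therefore counted through neighbour sets.
\<close>

definition neighbours :: "'a pair_pre_digraph \<Rightarrow> 'a \<Rightarrow> 'a set" where
  "neighbours G u = {w \<in> pverts G. (u, w) \<in> parcs G}"

definition degree :: "'a pair_pre_digraph \<Rightarrow> 'a \<Rightarrow> nat" where
  "degree G u = card (neighbours G u)"

definition is_clique :: "'a pair_pre_digraph \<Rightarrow> nat \<Rightarrow> 'a set \<Rightarrow> bool" where
  "is_clique G s S \<longleftrightarrow>
     S \<subseteq> pverts G \<and> finite S \<and> card S = s \<and> pairwise (\<lambda>u w. (u, w) \<in> parcs G) S"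

definition avg_degree :: "'a pair_pre_digraph \<Rightarrow> 'a set \<Rightarrow> real" where
  "avg_degree G S = (1 / real (card S)) * (\<Sum>u\<in>S. real (degree G u))"

text \<open>
  The sum ranges over the unordered pairs \<open>P = {u, w}\<close> of distinct elements of \<open>S\<close>, for which
  the intersection is the set of common neighbours of \<open>u\<close> and \<open>w\<close>. For a singleton \<open>S\<close> there
  are no such pairs and the average is \<open>0\<close>, as intended.
\<close>
definition avg_common :: "'a pair_pre_digraph \<Rightarrow> 'a set \<Rightarrow> real" where
  "avg_common G S =
     inverse (real (card S choose 2)) * (\<Sum>P\<in>nsets S 2. real (card (\<Inter>u\<in>P. neighbours G u)))"

definition T1 :: "nat \<Rightarrow> nat \<Rightarrow> real \<Rightarrow> real" where
  "T1 v s k = real v - (3 + 2 * k) * real s + 2 * (real s)^2"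

definition T2 :: "nat \<Rightarrow> nat \<Rightarrow> real \<Rightarrow> real" where
  "T2 v s l =
     4 * (real v - real s) * ((3 + l) * (real s)^2 - (real s)^3 - (2 + l) * real s)"

definition T3 :: "nat \<Rightarrow> nat \<Rightarrow> real \<Rightarrow> real" where
  "T3 v s k =
     (let x = (- real v + (3 + 2 * k) * real s - 2 * (real s)^2) / (2 * (real v - real s))
      in (real v - real s) * (1 - \<bar>2 * (x - real_of_int \<lfloor>x\<rfloor>) - 1\<bar>))"

definition CE :: "'a pair_pre_digraph \<Rightarrow> nat \<Rightarrow> real \<Rightarrow> real \<Rightarrow> real" where
  "CE G s k l =
     (let v = card (pverts G) in (T1 v s k)^2 - T2 v s l - (T3 v s k)^2)"

end

theory Submission
  imports Defs
begin

text \<open>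
  Let \<open>d x\<close> be the number of neighbours in the \<open>s\<close>-clique \<open>S\<close> of a vertex \<open>x\<close> outside \<open>S\<close>, and
  \<open>n = v - s\<close>. Counting the arcs leaving \<open>S\<close> and the pairs of \<open>S\<close> with an outside common neighbour gives
  \<open>A = (\<Sum>x. d x) = s (k - s + 1)\<close> and \<open>B = (\<Sum>x. d x (d x - 1)) = s (s - 1) (l - s + 2)\<close>.
  Since \<open>d x\<close> is an integer, \<open>(d x - c) (d x - c - 1) \<ge> 0\<close> for every integer \<open>c\<close>, so
  \<open>B - 2 c A + n c (c + 1) \<ge> 0\<close>. The choice of \<open>c\<close> as the integer nearest to \<open>A / n - 1 / 2\<close>
  turns this into \<open>T1\<^sup>2 - T2 - T3\<^sup>2 \<le> 0\<close>, because \<open>T1 = n - 2 A\<close>, \<open>T2 = 4 n B\<close>, and \<open>T3\<close> is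
  \<open>2 n\<close> times the distance from \<open>A / n - 1 / 2\<close> to the nearest integer.
\<close>

lemma sum_consecutive_prod_nonneg:
  fixes d :: "'a \<Rightarrow> nat" and c :: int
  shows "(\<Sum>x\<in>X. real (d x) * (real (d x) - 1)) - 2 * real_of_int c * (\<Sum>x\<in>X. real (d x))
    + real (card X) * (real_of_int c * (real_of_int c + 1)) \<ge> 0"
proof -
  have "(m - c) * (m - c - 1) \<ge> 0" for m :: int
    by (cases "m \<le> c") (auto intro: mult_nonpos_nonpos mult_nonneg_nonneg)
  then have "0 \<le> real_of_int ((int (d x) - c) * (int (d x) - c - 1))" for x
    by (simp only: of_int_0_le_iff)
  then have "0 \<le> (\<Sum>x\<in>X. real_of_int ((int (d x) - c) * (int (d x) - c - 1)))"
    by (intro sum_nonneg)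
  also have "\<dots> = (\<Sum>x\<in>X. real (d x) * (real (d x) - 1) - 2 * real_of_int c * real (d x)
      + real_of_int c * (real_of_int c + 1))"
    by (intro sum.cong) (auto simp: algebra_simps)
  also have "\<dots> = (\<Sum>x\<in>X. real (d x) * (real (d x) - 1)) - 2 * real_of_int c * (\<Sum>x\<in>X. real (d x))
    + real (card X) * (real_of_int c * (real_of_int c + 1))"
    by (simp add: sum.distrib sum_subtractf sum_distrib_left)
  finally show ?thesis .
qed

text \<open>With f the fractional part of \<open>x\<close>, the right-hand side is the triangle wave
  min(f, 1 - f). The floor is the witness for f \<le> 1/2, and the next integer otherwise.\<close>

lemma nearest_int_distance:
  fixes x :: real
  obtains c :: int where "\<bar>x - real_of_int c\<bar> = (1 - \<bar>2 * (x - real_of_int \<lfloor>x\<rfloor>) - 1\<bar>) / 2"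
proof -
  define f where "f = x - real_of_int \<lfloor>x\<rfloor>"
  have f: "0 \<le> f" "f < 1"
    using of_int_floor_le[of x] floor_correct[of x] unfolding f_def by linarith+
  show ?thesis
  proof (cases "f \<le> 1 / 2")
    case True
    with f have "\<bar>f\<bar> = (1 - \<bar>2 * f - 1\<bar>) / 2" by (simp add: abs_if)
    then show ?thesis by (intro that[of "\<lfloor>x\<rfloor>"]) (simp add: f_def)
  next
    case False
    with f have "\<bar>f - 1\<bar> = (1 - \<bar>2 * f - 1\<bar>) / 2" by (simp add: abs_if field_simps)
    moreover have "x - real_of_int (\<lfloor>x\<rfloor> + 1) = f - 1" by (simp add: f_def)
    ultimately show ?thesis by (intro that[of "\<lfloor>x\<rfloor> + 1"]) (simp only: f_def)
  qed
qed

lemma sum_card_filter_swap: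
  assumes "finite X" "finite Y"
  shows "(\<Sum>x\<in>X. card {y\<in>Y. R x y}) = (\<Sum>y\<in>Y. card {x\<in>X. R x y})"
  using assms by (intro sum_multicount_gen) auto

lemma real_choose_two: "real (m choose 2) = real m * (real m - 1) / 2"
proof -
  have "real (2 * (m choose 2)) = real (m * (m - 1))"
    by (simp only: choose_two dvd_mult_div_cancel even_mult_iff) (cases m; simp)
  \<comment> \<open>At m = 0 the natural-number subtraction truncates while the real m - 1 is -1,
    but the factor m annihilates both.\<close>
  then show ?thesis by (cases m) (auto simp: field_simps)
qed

context
  fixes G :: "'a pair_pre_digraph" and S :: "'a set" and s :: nat
  assumes G: "pair_graph G" and S: "is_clique G s S"
begin

lemma finite_verts: "finite (pverts G)"
proof -
  interpret pair_graph G by (rule G)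
  show ?thesis by (rule pair_finite_verts)
qed

lemma not_neighbour_self: "u \<notin> neighbours G u"
proof -
  interpret pair_graph G by (rule G)
  show ?thesis using no_loops'[of u u] by (auto simp: neighbours_def)
qed

lemma finite_neighbours: "finite (neighbours G u)"
  using finite_verts by (simp add: neighbours_def)

lemma clique_simps: "S \<subseteq> pverts G" "finite S" "card S = s"
  using S by (auto simp: is_clique_def)

text \<open>No vertex of \<open>P\<close> is its own neighbour, while every other vertex of the
  clique is adjacent to all of \<open>P\<close>. For empty \<open>P\<close> the intersection is
  \<open>UNIV\<close>, which agrees.\<close>

lemma common_neighbours_in_clique:
  assumes "P \<subseteq> S"
  shows "(\<Inter>u\<in>P. neighbours G u) \<inter> S = S - P"
proof
  show "(\<Inter>u\<in>P. neighbours G u) \<inter> S \<subseteq> S - P"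
    using not_neighbour_self by blast
  have "x \<in> neighbours G u" if "x \<in> S - P" "u \<in> P" for x u
  proof -
    have "u \<in> S" "x \<in> S" "u \<noteq> x" using that assms by auto
    then show ?thesis using S by (auto simp: neighbours_def is_clique_def pairwise_def)
  qed
  then show "S - P \<subseteq> (\<Inter>u\<in>P. neighbours G u) \<inter> S" by blast
qed

text \<open>Common neighbours of \<open>P\<close> inside the clique are exactly the s - |P| members
  of \<open>S - P\<close>; the others lie outside. Singletons \<open>P\<close> serve the count of
  arcs, two-element sets the count of pairs.\<close>

lemma card_common_neighbours_outside:
  assumes "P \<subseteq> S" "P \<noteq> {}"
  shows "real (card {x \<in> pverts G - S. \<forall>u\<in>P. x \<in> neighbours G u})
    = real (card (\<Inter>u\<in>P. neighbours G u)) - (real s - real (card P))"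
proof -
  let ?I = "\<Inter>u\<in>P. neighbours G u"
  obtain u where "u \<in> P" using assms by auto
  then have fin: "finite ?I" using finite_neighbours by (meson INT_lower finite_subset)
  have "{x \<in> pverts G - S. \<forall>u\<in>P. x \<in> neighbours G u} = ?I - S"
    using assms(2) by (auto simp: neighbours_def)
  moreover have "card ?I = card (?I - S) + card (?I \<inter> S)"
    using fin by (metis add.commute card_Int_Diff)
  moreover have "card (?I \<inter> S) = s - card P" "card P \<le> s"
    using common_neighbours_in_clique[OF assms(1)] clique_simps assms
    by (auto simp: card_Diff_subset finite_subset card_mono)
  ultimately show ?thesis by simp
qed

lemma sum_outside_degree:
  assumes "0 < s"
  shows "(\<Sum>x\<in>pverts G - S. real (card {u\<in>S. x \<in> neighbours G u}))
    = real s * (avg_degree G S - real s + 1)"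
proof -
  have "(\<Sum>x\<in>pverts G - S. real (card {u\<in>S. x \<in> neighbours G u}))
      = (\<Sum>u\<in>S. real (card {x\<in>pverts G - S. x \<in> neighbours G u}))"
    using sum_card_filter_swap[of "pverts G - S" S "\<lambda>x u. x \<in> neighbours G u"]
      finite_verts clique_simps by (simp flip: of_nat_sum)
  also have "\<dots> = (\<Sum>u\<in>S. real (degree G u) - (real s - 1))"
  proof (rule sum.cong)
    fix u assume "u \<in> S"
    then show "real (card {x\<in>pverts G - S. x \<in> neighbours G u}) = real (degree G u) - (real s - 1)"
      using card_common_neighbours_outside[of "{u}"] by (simp add: degree_def)
  qed simp
  also have "\<dots> = real s * (avg_degree G S - real s + 1)"
    using assms clique_simps by (simp add: avg_degree_def sum_subtractf sum.distrib field_simps)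
  finally show ?thesis .
qed

lemma sum_outside_pairs:
  "(\<Sum>x\<in>pverts G - S. real (card {u\<in>S. x \<in> neighbours G u})
      * (real (card {u\<in>S. x \<in> neighbours G u}) - 1))
    = real s * (real s - 1) * (avg_common G S - real s + 2)"
proof -
  let ?N = "neighbours G" and ?C = "\<lambda>P. \<Inter>u\<in>P. neighbours G u"
  have cS: "card S choose 2 = s choose 2"
    using clique_simps by simp
  have fin: "finite (nsets S 2)" and cardN: "card (nsets S 2) = s choose 2"
    using clique_simps by (simp_all add: finite_imp_finite_nsets)
  \<comment> \<open>An outside vertex x thus contributes (d x choose 2) to the number of incidences
    with pairs of \<open>S\<close>.\<close>
  have eq: "{P \<in> nsets S 2. \<forall>u\<in>P. x \<in> ?N u} = nsets {u\<in>S. x \<in> ?N u} 2" for x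
    by (auto simp: nsets_def)
  have "(\<Sum>x\<in>pverts G - S. real (card {u\<in>S. x \<in> ?N u} choose 2))
      = (\<Sum>x\<in>pverts G - S. real (card {P \<in> nsets S 2. \<forall>u\<in>P. x \<in> ?N u}))"
    by (simp add: eq)
  also have "\<dots> = (\<Sum>P\<in>nsets S 2. real (card {x\<in>pverts G - S. \<forall>u\<in>P. x \<in> ?N u}))"
    using sum_card_filter_swap[of "pverts G - S" "nsets S 2" "\<lambda>x P. \<forall>u\<in>P. x \<in> ?N u"]
      finite_verts fin by (simp flip: of_nat_sum)
  also have "\<dots> = (\<Sum>P\<in>nsets S 2. real (card (?C P)) - (real s - 2))"
  proof (rule sum.cong)
    fix P assume "P \<in> nsets S 2"
    then have "P \<subseteq> S" "P \<noteq> {}" "card P = 2" by (auto simp: nsets_def)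
    then show "real (card {x\<in>pverts G - S. \<forall>u\<in>P. x \<in> ?N u}) = real (card (?C P)) - (real s - 2)"
      using card_common_neighbours_outside[of P] by simp
  qed simp
  also have "\<dots> = (\<Sum>P\<in>nsets S 2. real (card (?C P))) - real (s choose 2) * (real s - 2)"
    by (simp add: sum_subtractf cS)
  also have "(\<Sum>P\<in>nsets S 2. real (card (?C P))) = real (s choose 2) * avg_common G S"
  \<comment> \<open>Without pairs, clearing the denominator of \<open>avg_common\<close> is
    impossible, but both sides vanish.\<close>
  proof (cases "s choose 2 = 0")
    case True
    then have "nsets S 2 = {}" using cardN fin by (metis card_0_eq)
    then show ?thesis using True by simp
  next
    case False
    then show ?thesis by (simp add: avg_common_def cS)
  qed
  finally have "(\<Sum>x\<in>pverts G - S. real (card {u\<in>S. x \<in> ?N u} choose 2))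
    = real (s choose 2) * avg_common G S - real (s choose 2) * (real s - 2)" .
  \<comment> \<open>Doubling turns each (d x choose 2) into d x (d x - 1).\<close>
  then show ?thesis
    by (simp add: real_choose_two field_simps flip: sum_divide_distrib)
qed

end

theorem lemma3p1:
  fixes G :: "'a pair_pre_digraph" and v s :: nat and k l :: real
  assumes "pair_graph G"
    and "v = card (pverts G)"
    and "0 < s" and "s < v"
    and "CE G s k l > 0"
  shows "\<not> (\<exists>S. is_clique G s S \<and> (avg_degree G S, avg_common G S) = (k, l))"
proof
  assume "\<exists>S. is_clique G s S \<and> (avg_degree G S, avg_common G S) = (k, l)"
  then obtain S where S: "is_clique G s S" and k: "avg_degree G S = k" and l: "avg_common G S = l"
    by auto
  define n where "n = real v - real s"
  define A where "A = real s * (k - real s + 1)"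
  define B where "B = real s * (real s - 1) * (l - real s + 2)"
  \<comment> \<open>This is the vertex of the quadratic in \<open>c\<close>: B - 2 c A + n c (c + 1)
    = B + n ((c - x)^2 - x^2). Hence the integer nearest to \<open>x\<close> gives the strongest
    inequality.\<close>
  define x where "x = A / n - 1 / 2"
  have n: "n > 0" using assms(4) by (simp add: n_def)
  have "real (card (pverts G - S)) = n"
    using clique_simps[OF assms(1) S] assms(2,4) by (simp add: card_Diff_subset n_def)
  then have ineq: "B - 2 * real_of_int c * A + n * (real_of_int c * (real_of_int c + 1)) \<ge> 0" for c
    using sum_consecutive_prod_nonneg[of "\<lambda>x. card {u\<in>S. x \<in> neighbours G u}" "pverts G - S" c]
      sum_outside_degree[OF assms(1) S assms(3)] sum_outside_pairs[OF assms(1) S]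
    by (simp add: A_def B_def k l)
  obtain c where c: "\<bar>x - real_of_int c\<bar> = (1 - \<bar>2 * (x - real_of_int \<lfloor>x\<rfloor>) - 1\<bar>) / 2"
    by (rule nearest_int_distance)
  have A: "A = n * (x + 1 / 2)" using n by (simp add: x_def)
  have T1: "T1 v s k = - 2 * n * x"
  proof -
    have "T1 v s k = n - 2 * A"
      by (simp add: T1_def A_def n_def power2_eq_square algebra_simps)
    then show ?thesis by (simp add: A algebra_simps)
  qed
  have T2: "T2 v s l = 4 * n * B"
    by (simp add: T2_def B_def n_def power2_eq_square power3_eq_cube algebra_simps)
  \<comment> \<open>The argument of the floor in \<open>T3\<close> is \<open>x\<close> itself, so
    \<open>T3\<close> measures the distance to the chosen \<open>c\<close>.\<close>
  have "(- real v + (3 + 2 * k) * real s - 2 * (real s)^2) / (2 * (real v - real s)) = - T1 v s k / (2 * n)"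
    by (simp add: T1_def n_def)
  also have "\<dots> = x" using n T1 by simp
  finally have T3: "T3 v s k = 2 * n * \<bar>x - real_of_int c\<bar>"
    by (simp add: T3_def c flip: n_def)
  have "CE G s k l = (2 * n * x)^2 - 4 * n * B - (2 * n * (x - real_of_int c))^2"
    unfolding CE_def Let_def assms(2)[symmetric] by (simp add: T1 T2 T3 power_mult_distrib)
  \<comment> \<open>The squares of \<open>x\<close> cancel: x^2 - (x - c)^2 = 2 c x - c^2, and 2 n x
    = 2 A - n.\<close>
  also have "\<dots> = - (4 * n * (B - 2 * real_of_int c * A + n * (real_of_int c * (real_of_int c + 1))))"
    by (simp add: A power2_eq_square algebra_simps)
  also have "\<dots> \<le> 0" using n ineq[of c] by simp
  finally show False using assms(5) by simp
qed

end
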